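(* Let $\langle S,F\rangle$ be a non-paradoxical $\mathcal{F}$-system such that $F$ is transitive. If $x,y,z\in S$ are such that $(x,y)\in F$ and $(y,z)\in F$, then $x$ is a referential contradiction.
   Context: An $\mathcal{F}$-system is a pair $\langle S, F\rangle$ where $S$ is a set (its elements are called sentences) and $F\subseteq S\times S$ is a binary relation. For $x\in S$ put $\overrightarrow{F}(x)=\{y\in S: (x,y)\in F\}$. A sentence $x$ is a sink if $\overrightarrow{F}(x)=\emptyset$, and $sinks(S)$ is the set of sinks in $S$. A labelling on $\langle S,F\rangle$ is a total function $L:S\to\{\mathtt{T},\mathtt{F},\mathtt{U}\}$ (three distinct labels) such that for all $x\in S\setminus sinks(S)$: (a) $L(x)=\mathtt{F}$ iff $L(z)=\mathtt{T}$ for some $z\in\overrightarrow{F}(x)$; and (b) $L(x)=\mathtt{T}$ iff $L(z)=\mathtt{F}$ for every $z\in\overrightarrow{F}(x)$. (Labels of sinks are unrestricted.) A labelling $L$ is classical iff $L(x)\neq\mathtt{U}$ for every $x\in S$. An $\mathcal{F}$-system is paradoxical iff it has no classical labellings. A sentence $x\in S$ is a referential contradiction iff $L(x)=\mathtt{F}$ for every classical labelling $L$. *)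

theory Defs
  imports Main
begin

definition F_system :: "'a set \<Rightarrow> ('a \<times> 'a) set \<Rightarrow> bool" where
  "F_system S F \<longleftrightarrow> F \<subseteq> S \<times> S"

definition out_set :: "('a \<times> 'a) set \<Rightarrow> 'a \<Rightarrow> 'a set" where
  "out_set F x = F `` {x}"

definition sinks :: "'a set \<Rightarrow> ('a \<times> 'a) set \<Rightarrow> 'a set" where
  "sinks S F = {x \<in> S. out_set F x = {}}"

datatype label = TrueL | FalseL | UndefL

(* A labelling of S is represented by a function on the whole type; its values outside S
   are irrelevant, since the definitions below only inspect L on S (given F \<subseteq> S \<times> S). *)

definition labelling :: "'a set \<Rightarrow> ('a \<times> 'a) set \<Rightarrow> ('a \<Rightarrow> label) \<Rightarrow> bool" where
  "labelling S F L \<longleftrightarrow>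
     (\<forall>x \<in> S - sinks S F.
        (L x = FalseL \<longleftrightarrow> (\<exists>z \<in> out_set F x. L z = TrueL)) \<and>
        (L x = TrueL \<longleftrightarrow> (\<forall>z \<in> out_set F x. L z = FalseL)))"

definition classical_labelling :: "'a set \<Rightarrow> ('a \<times> 'a) set \<Rightarrow> ('a \<Rightarrow> label) \<Rightarrow> bool" where
  "classical_labelling S F L \<longleftrightarrow> labelling S F L \<and> (\<forall>x \<in> S. L x \<noteq> UndefL)"

definition paradoxical :: "'a set \<Rightarrow> ('a \<times> 'a) set \<Rightarrow> bool" where
  "paradoxical S F \<longleftrightarrow> \<not> (\<exists>L. classical_labelling S F L)"

definition referential_contradiction :: "'a set \<Rightarrow> ('a \<times> 'a) set \<Rightarrow> 'a \<Rightarrow> bool" where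
  "referential_contradiction S F x \<longleftrightarrow>
     x \<in> S \<and> (\<forall>L. classical_labelling S F L \<longrightarrow> L x = FalseL)"

end

theory Submission
  imports Defs
begin

text \<open>If a classical labelling made \<open>x\<close> true, all successors of \<open>x\<close>,
  including \<open>y\<close>, would be false. A false non-sink has a true successor, so
  \<open>y\<close> has one, and transitivity makes it a successor of \<open>x\<close> as well: it
  would be both true and false. Since \<open>UndefL\<close> is excluded, \<open>x\<close> must be
  false.\<close>

text \<open>The edge to \<open>y\<close> certifies that \<open>x\<close> is not a sink, so the
  labelling conditions bind at \<open>x\<close>.\<close>

lemma labelling_FalseL_iff:
  assumes "labelling S F L" and "x \<in> S" and "(x, y) \<in> F"
  shows "L x = FalseL \<longleftrightarrow> (\<exists>w. (x, w) \<in> F \<and> L w = TrueL)"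
  using assms by (auto simp: labelling_def sinks_def out_set_def)

lemma labelling_TrueL_iff:
  assumes "labelling S F L" and "x \<in> S" and "(x, y) \<in> F"
  shows "L x = TrueL \<longleftrightarrow> (\<forall>w. (x, w) \<in> F \<longrightarrow> L w = FalseL)"
  using assms by (auto simp: labelling_def sinks_def out_set_def)

theorem proposition3:
  fixes S :: "'a set" and F :: "('a \<times> 'a) set" and x y z :: 'a
  assumes "F_system S F"
    and "\<not> paradoxical S F"
    and "trans F"
    and "x \<in> S" and "y \<in> S" and "z \<in> S"
    and "(x, y) \<in> F" and "(y, z) \<in> F"
  shows "referential_contradiction S F x"
  unfolding referential_contradiction_def
proof (intro conjI allI impI)
  show "x \<in> S" by fact
next
  fix L assume "classical_labelling S F L"
  then have L: "labelling S F L" and "L x \<noteq> UndefL"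
    using \<open>x \<in> S\<close> by (auto simp: classical_labelling_def)
  have "L x \<noteq> TrueL"
  proof
    assume "L x = TrueL"
    then have all_false: "L w = FalseL" if "(x, w) \<in> F" for w
      using labelling_TrueL_iff[OF L \<open>x \<in> S\<close> \<open>(x, y) \<in> F\<close>] that by blast
    \<comment> \<open>The edge to \<open>z\<close> shows that \<open>y\<close> is not a sink; the
      true successor \<open>w\<close> may differ from \<open>z\<close>.\<close>
    obtain w where "(y, w) \<in> F" "L w = TrueL"
      using labelling_FalseL_iff[OF L \<open>y \<in> S\<close> \<open>(y, z) \<in> F\<close>] all_false[OF \<open>(x, y) \<in> F\<close>] by blast
    \<comment> \<open>Transitivity brings \<open>w\<close> under \<open>all_false\<close>, against
      \<open>L w = TrueL\<close>.\<close>
    moreover have "(x, w) \<in> F"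
      using \<open>trans F\<close> \<open>(x, y) \<in> F\<close> \<open>(y, w) \<in> F\<close> by (rule transD)
    ultimately show False using all_false by fastforce
  qed
  with \<open>L x \<noteq> UndefL\<close> show "L x = FalseL" by (cases "L x") auto
qed

end
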